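(* Let $\mathsf L$ be an intermediate logic with $\mathsf L\subseteq\mathsf L(\mathfrak R_2)$ which has unitary unification. Then there is an $\mathsf L$-unifiable formula $A\in\mathsf{Fm}^n$ (for some $n$) such that all its most general unifiers introduce new variables, i.e. $A$ has no most general unifier of the form $\varepsilon:\{x_1,\dots,x_n\}\to\mathsf{Fm}^n$.
   Context: Formulas are built from variables $x_1,x_2,\dots$ with $\to,\lor,\land,\bot$; $\mathsf{Fm}^n$ is the set of formulas in $x_1,\dots,x_n$. An intermediate logic is a set of formulas containing $\mathsf{INT}$, closed under modus ponens and substitution. A frame is a finite partially ordered set with a least element (root); $\mathsf L(\mathfrak F)$ is the set of formulas valid in every intuitionistic Kripke model over the frame $\mathfrak F$. $\mathfrak R_2$ is the four-element rhombus frame: root $r$, two incomparable elements $a,b$ above $r$, and a top element $t$ above $a$ and $b$. A substitution $\sigma:\{x_1,\dots,x_n\}\to\mathsf{Fm}^k$ is an $\mathsf L$-unifier of $A$ if $\sigma(A)\in\mathsf L$; $\varepsilon\preccurlyeq\mu$ iff $\alpha\circ\varepsilon$ and $\mu$ are $\mathsf L$-equivalent (on all formulas) for some substitution $\alpha$. A most general unifier (mgu) of $A$ is a unifier $\varepsilon$ with $\varepsilon\preccurlyeq\mu$ for all unifiers $\mu$ of $A$. Unification in $\mathsf L$ is unitary if every unifiable formula has an mgu. No local tabularity of $\mathsf L$ is assumed. *)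

theory Defs
  imports Main "HOL-Library.FuncSet"
begin

section \<open>Formulas, substitutions, intermediate logics\<close>

text \<open>Variables are numbered from 0: \<open>Var i\<close> is the variable $x_{i+1}$, so that the
  variables $x_1,\dots,x_n$ are \<open>Var i\<close> for \<open>i < n\<close>.\<close>

datatype fm = Var nat | Bot | And fm fm | Or fm fm | Imp fm fm

abbreviation Iff :: "fm \<Rightarrow> fm \<Rightarrow> fm" where
  "Iff A B \<equiv> And (Imp A B) (Imp B A)"

primrec vars :: "fm \<Rightarrow> nat set" where
  "vars (Var i) = {i}"
| "vars Bot = {}"
| "vars (And A B) = vars A \<union> vars B"
| "vars (Or A B) = vars A \<union> vars B"
| "vars (Imp A B) = vars A \<union> vars B"

definition Fm :: "nat \<Rightarrow> fm set" where
  "Fm n = {A. vars A \<subseteq> {..<n}}"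

primrec subst :: "(nat \<Rightarrow> fm) \<Rightarrow> fm \<Rightarrow> fm" where
  "subst \<sigma> (Var i) = \<sigma> i"
| "subst \<sigma> Bot = Bot"
| "subst \<sigma> (And A B) = And (subst \<sigma> A) (subst \<sigma> B)"
| "subst \<sigma> (Or A B) = Or (subst \<sigma> A) (subst \<sigma> B)"
| "subst \<sigma> (Imp A B) = Imp (subst \<sigma> A) (subst \<sigma> B)"

inductive_set IPC :: "fm set" where
  K: "Imp A (Imp B A) \<in> IPC"
| S: "Imp (Imp A (Imp B C)) (Imp (Imp A B) (Imp A C)) \<in> IPC"
| AndE1: "Imp (And A B) A \<in> IPC"
| AndE2: "Imp (And A B) B \<in> IPC"
| AndI: "Imp A (Imp B (And A B)) \<in> IPC"
| OrI1: "Imp A (Or A B) \<in> IPC"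
| OrI2: "Imp B (Or A B) \<in> IPC"
| OrE: "Imp (Imp A C) (Imp (Imp B C) (Imp (Or A B) C)) \<in> IPC"
| BotE: "Imp Bot A \<in> IPC"
| MP: "Imp A B \<in> IPC \<Longrightarrow> A \<in> IPC \<Longrightarrow> B \<in> IPC"

definition intermediate_logic :: "fm set \<Rightarrow> bool" where
  "intermediate_logic L \<longleftrightarrow>
     IPC \<subseteq> L \<and>
     (\<forall>A B. Imp A B \<in> L \<longrightarrow> A \<in> L \<longrightarrow> B \<in> L) \<and>
     (\<forall>\<sigma> A. A \<in> L \<longrightarrow> subst \<sigma> A \<in> L)"

section \<open>Kripke semantics\<close>

definition frame :: "'w set \<Rightarrow> 'w rel \<Rightarrow> bool" where
  "frame W R \<longleftrightarrow> finite W \<and> partial_order_on W R \<and> (\<exists>r\<in>W. \<forall>w\<in>W. (r, w) \<in> R)"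

definition persistent_valuation :: "'w set \<Rightarrow> 'w rel \<Rightarrow> (nat \<Rightarrow> 'w set) \<Rightarrow> bool" where
  "persistent_valuation W R V \<longleftrightarrow>
     (\<forall>i. V i \<subseteq> W \<and> (\<forall>w v. w \<in> V i \<longrightarrow> (w, v) \<in> R \<longrightarrow> v \<in> V i))"

primrec forces :: "'w rel \<Rightarrow> (nat \<Rightarrow> 'w set) \<Rightarrow> 'w \<Rightarrow> fm \<Rightarrow> bool" where
  "forces R V w (Var i) \<longleftrightarrow> w \<in> V i"
| "forces R V w Bot \<longleftrightarrow> False"
| "forces R V w (And A B) \<longleftrightarrow> forces R V w A \<and> forces R V w B"
| "forces R V w (Or A B) \<longleftrightarrow> forces R V w A \<or> forces R V w B"
| "forces R V w (Imp A B) \<longleftrightarrow>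
     (\<forall>v. (w, v) \<in> R \<longrightarrow> forces R V v A \<longrightarrow> forces R V v B)"

definition logic_of_frame :: "'w set \<Rightarrow> 'w rel \<Rightarrow> fm set" where
  "logic_of_frame W R =
     {A. \<forall>V. persistent_valuation W R V \<longrightarrow> (\<forall>w\<in>W. forces R V w A)}"

datatype rhombus = Root | MidA | MidB | Top

definition R2 :: "rhombus rel" where
  "R2 = {(x, y). x = y \<or> x = Root \<or> y = Top}"

lemma frame_R2: "frame UNIV R2"
proof -
  have "(UNIV :: rhombus set) = {Root, MidA, MidB, Top}"
    using rhombus.exhaust by auto
  then have "finite (UNIV :: rhombus set)"
    by (metis finite.emptyI finite.insertI)
  then show ?thesis
    by (auto simp: frame_def R2_def partial_order_on_def preorder_on_def refl_on_def
        trans_def antisym_def)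
qed

section \<open>Unification\<close>

text \<open>A substitution $\{x_1,\dots,x_n\}\to\mathsf{Fm}^k$ is a function in \<open>{..<n} \<rightarrow> Fm k\<close>;
  its values outside \<open>{..<n}\<close> are irrelevant, and it acts on formulas in \<open>Fm n\<close> only.\<close>

definition unifier :: "fm set \<Rightarrow> nat \<Rightarrow> nat \<Rightarrow> fm \<Rightarrow> (nat \<Rightarrow> fm) \<Rightarrow> bool" where
  "unifier L n k A \<sigma> \<longleftrightarrow> A \<in> Fm n \<and> \<sigma> \<in> {..<n} \<rightarrow> Fm k \<and> subst \<sigma> A \<in> L"

definition unifiable :: "fm set \<Rightarrow> nat \<Rightarrow> fm \<Rightarrow> bool" where
  "unifiable L n A \<longleftrightarrow> (\<exists>k \<sigma>. unifier L n k A \<sigma>)"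

text \<open>\<open>more_general L n k m \<epsilon> \<mu>\<close> is the relation $\varepsilon\preccurlyeq\mu$ for
  $\varepsilon:\{x_1,\dots,x_n\}\to\mathsf{Fm}^k$ and $\mu:\{x_1,\dots,x_n\}\to\mathsf{Fm}^m$.\<close>

definition more_general ::
    "fm set \<Rightarrow> nat \<Rightarrow> nat \<Rightarrow> nat \<Rightarrow> (nat \<Rightarrow> fm) \<Rightarrow> (nat \<Rightarrow> fm) \<Rightarrow> bool" where
  "more_general L n k m \<epsilon> \<mu> \<longleftrightarrow>
     (\<exists>\<alpha> \<in> {..<k} \<rightarrow> Fm m. \<forall>B \<in> Fm n. Iff (subst \<alpha> (subst \<epsilon> B)) (subst \<mu> B) \<in> L)"

definition mgu :: "fm set \<Rightarrow> nat \<Rightarrow> nat \<Rightarrow> fm \<Rightarrow> (nat \<Rightarrow> fm) \<Rightarrow> bool" where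
  "mgu L n k A \<epsilon> \<longleftrightarrow>
     unifier L n k A \<epsilon> \<and> (\<forall>m \<mu>. unifier L n m A \<mu> \<longrightarrow> more_general L n k m \<epsilon> \<mu>)"

definition unitary_unification :: "fm set \<Rightarrow> bool" where
  "unitary_unification L \<longleftrightarrow>
     (\<forall>n. \<forall>A \<in> Fm n. unifiable L n A \<longrightarrow> (\<exists>k \<epsilon>. mgu L n k A \<epsilon>))"

end

theory Submission
  imports Defs
begin

text \<open>Take \<open>A = \<not>\<not>x \<rightarrow> \<not>\<not>y \<rightarrow> x \<or> y\<close>, where \<open>n = 2\<close>. On the rhombus, the action of a substitution
  \<open>\<epsilon>\<close> at the top depends only on the classical valuation of the variables there, so an
  \<open>\<epsilon>\<close> in two variables induces a self-map of the four classical valuations. If \<open>\<epsilon>\<close> is below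
  the four ground unifiers given by \<open>\<bottom>\<close> and \<open>\<top>\<close>, then this map is onto, hence
  injective. Thus instances of \<open>\<epsilon>\<close> yielding \<open>(\<top>, z \<or> \<not>z)\<close> and \<open>(z \<or> \<not>z, \<top>)\<close> agree
  at the top of the rhombus. Gluing the first on one side to the second on the other side gives
  a model in which \<open>\<epsilon>(x)\<close> and \<open>\<epsilon>(y)\<close> hold at the top and each fails at one middle point, so
  \<open>\<epsilon>(A)\<close> fails at the root.\<close>

lemma persistent_valuationD:
  "persistent_valuation W R V \<Longrightarrow> w \<in> V i \<Longrightarrow> (w, v) \<in> R \<Longrightarrow> v \<in> V i"
  unfolding persistent_valuation_def by blast

lemma forces_mono:
  assumes "trans R" and "persistent_valuation W R V" and "forces R V w A" and "(w, v) \<in> R"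
  shows "forces R V v A"
  using assms(3,4)
proof (induction A)
  case (Var i)
  then show ?case using persistent_valuationD[OF assms(2)] by simp
next
  case (Imp A B)
  then show ?case using assms(1) by (auto dest: transD)
qed auto

lemma forces_subst:
  "forces R V w (subst \<sigma> A) \<longleftrightarrow> forces R (\<lambda>i. {w. forces R V w (\<sigma> i)}) w A"
  by (induction A arbitrary: w) auto

lemma forces_cong:
  assumes "trans R"
    and "(w, w) \<in> R"
    and "\<And>i v. i \<in> vars A \<Longrightarrow> (w, v) \<in> R \<Longrightarrow> v \<in> U i \<longleftrightarrow> v \<in> V i"
    and "refl R"
  shows "forces R U w A \<longleftrightarrow> forces R V w A"
  using assms(2,3)
proof (induction A arbitrary: w)
  case (Imp A B)
  have "forces R U v A \<longleftrightarrow> forces R V v A" "forces R U v B \<longleftrightarrow> forces R V v B" if "(w, v) \<in> R" for v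
    using Imp.prems that assms(1,4)
    by (auto intro!: Imp.IH dest: transD simp: refl_on_def)
  then show ?case by simp
qed auto

lemma persistent_forces:
  assumes "trans R" and "persistent_valuation UNIV R V"
  shows "persistent_valuation UNIV R (\<lambda>i. {w. forces R V w (\<sigma> i)})"
  using forces_mono[OF assms] by (auto simp: persistent_valuation_def)

lemma trans_R2: "trans R2" and refl_R2: "refl R2"
  using frame_R2 by (auto simp: frame_def partial_order_on_def preorder_on_def)

abbreviation Neg :: "fm \<Rightarrow> fm" where
  "Neg A \<equiv> Imp A Bot"

abbreviation Truth :: fm where
  "Truth \<equiv> Imp Bot Bot"

definition dense_disj :: fm where
  "dense_disj = Imp (Neg (Neg (Var 0))) (Imp (Neg (Neg (Var 1))) (Or (Var 0) (Var 1)))"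

lemma dense_disj_Fm: "dense_disj \<in> Fm 2"
  by (auto simp: dense_disj_def Fm_def)

lemma IPC_weaken: "B \<in> IPC \<Longrightarrow> Imp A B \<in> IPC"
  by (rule IPC.MP[OF IPC.K])

lemma IPC_neg_Truth: "Imp (Neg Truth) C \<in> IPC"
proof -
  have "Imp (Neg Truth) (Neg Truth) \<in> IPC"
    \<comment> \<open>The identity as the combinator term \<open>S K K\<close>; the next step
      applies it to \<open>Truth\<close>.\<close>
    by (rule IPC.MP[OF IPC.MP[OF IPC.S IPC.K] IPC.K[of _ Bot]])
  then have "Imp (Neg Truth) Bot \<in> IPC"
    by (rule IPC.MP[OF IPC.MP[OF IPC.S] IPC_weaken[OF IPC.BotE]])
  then show ?thesis
    by (rule IPC.MP[OF IPC.MP[OF IPC.S IPC_weaken[OF IPC.BotE]]])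
qed

text \<open>\<open>Bot\<close> refutes the first premise, and \<open>Truth\<close> proves the
  disjunction. The cases cover the four ground pairs and both pairs of \<open>Truth\<close> with an
  arbitrary formula.\<close>

lemma unifier_dense_disj:
  assumes "intermediate_logic L" and "\<mu> 0 \<in> Fm m" and "\<mu> 1 \<in> Fm m"
    and "\<mu> 0 = Bot \<or> \<mu> 0 = Truth \<or> \<mu> 1 = Truth"
  shows "unifier L 2 m dense_disj \<mu>"
proof -
  have "\<mu> \<in> {..<2} \<rightarrow> Fm m"
    using assms(2,3) by (auto simp: less_2_cases_iff)
  moreover have "subst \<mu> dense_disj \<in> IPC"
    using assms(4)
  proof (elim disjE)
    assume "\<mu> 0 = Bot"
    then show ?thesis by (simp add: dense_disj_def IPC_neg_Truth)
  next
    assume "\<mu> 0 = Truth"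
    then have "Or (\<mu> 0) (\<mu> 1) \<in> IPC" by (simp add: IPC.MP[OF IPC.OrI1 IPC.BotE])
    then show ?thesis by (simp add: dense_disj_def IPC_weaken)
  next
    assume "\<mu> 1 = Truth"
    then have "Or (\<mu> 0) (\<mu> 1) \<in> IPC" by (simp add: IPC.MP[OF IPC.OrI2 IPC.BotE])
    then show ?thesis by (simp add: dense_disj_def IPC_weaken)
  qed
  ultimately show ?thesis
    using assms(1) dense_disj_Fm by (auto simp: unifier_def intermediate_logic_def)
qed

text \<open>Pull \<open>V\<close> back along the substitution \<alpha> that witnesses generality:
  \<open>U i\<close> is the set of points forcing \<alpha>\<open>i\<close>.\<close>

lemma more_general_valuation:
  assumes "L \<subseteq> logic_of_frame UNIV R2" and "more_general L n k m \<epsilon> \<mu>"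
    and "persistent_valuation UNIV R2 V"
  obtains U where "persistent_valuation UNIV R2 U"
    and "\<And>i w. i < n \<Longrightarrow> forces R2 U w (\<epsilon> i) \<longleftrightarrow> forces R2 V w (\<mu> i)"
proof -
  obtain \<alpha> where \<alpha>: "\<And>B. B \<in> Fm n \<Longrightarrow> Iff (subst \<alpha> (subst \<epsilon> B)) (subst \<mu> B) \<in> L"
    using assms(2) by (auto simp: more_general_def)
  let ?U = "\<lambda>i. {w. forces R2 V w (\<alpha> i)}"
  have "forces R2 ?U w (\<epsilon> i) \<longleftrightarrow> forces R2 V w (\<mu> i)" if "i < n" for i w
  proof -
    have "Iff (subst \<alpha> (\<epsilon> i)) (\<mu> i) \<in> logic_of_frame UNIV R2"
      using \<alpha>[of "Var i"] that assms(1) by (auto simp: Fm_def)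
    then have "forces R2 V w (Iff (subst \<alpha> (\<epsilon> i)) (\<mu> i))"
      using assms(3) by (simp add: logic_of_frame_def)
    then have "forces R2 V w (subst \<alpha> (\<epsilon> i)) \<longleftrightarrow> forces R2 V w (\<mu> i)"
      using refl_R2 by (auto simp: refl_on_def)
    then show ?thesis by (simp add: forces_subst)
  qed
  then show thesis
    using that persistent_forces[OF trans_R2 assms(3)] by blast
qed

text \<open>The root lies in no value, and the union at \<open>Top\<close> keeps persistence even
  where \<open>U\<close> and \<open>V\<close> disagree.\<close>

definition glue :: "(nat \<Rightarrow> rhombus set) \<Rightarrow> (nat \<Rightarrow> rhombus set) \<Rightarrow> nat \<Rightarrow> rhombus set" where
  "glue U V i = U i \<inter> {MidA, Top} \<union> V i \<inter> {MidB, Top}"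

lemma persistent_glue:
  assumes "persistent_valuation UNIV R2 U" and "persistent_valuation UNIV R2 V"
  shows "persistent_valuation UNIV R2 (glue U V)"
  unfolding persistent_valuation_def
proof (intro allI conjI impI subset_UNIV)
  fix i w v
  have "Top \<in> U i" if "MidA \<in> U i"
    using persistent_valuationD[OF assms(1) that] by (simp add: R2_def)
  moreover have "Top \<in> V i" if "MidB \<in> V i"
    using persistent_valuationD[OF assms(2) that] by (simp add: R2_def)
  moreover assume "w \<in> glue U V i" "(w, v) \<in> R2"
  ultimately show "v \<in> glue U V i"
    by (cases w; cases v) (simp_all add: glue_def R2_def)
qed

text \<open>Forcing looks only upward, and a middle point sees just itself and \<open>Top\<close>.
  Agreement at \<open>Top\<close> thus hides the other side from it.\<close>

lemma forces_glue:
  assumes "\<forall>i\<in>vars A. Top \<in> U i \<longleftrightarrow> Top \<in> V i"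
  shows "forces R2 (glue U V) MidA A \<longleftrightarrow> forces R2 U MidA A"
    and "forces R2 (glue U V) MidB A \<longleftrightarrow> forces R2 V MidB A"
    and "forces R2 (glue U V) Top A \<longleftrightarrow> forces R2 U Top A"
proof -
  have refl: "(w, w) \<in> R2" for w
    by (simp add: R2_def)
  have "v \<in> glue U V i \<longleftrightarrow> v \<in> U i" if "i \<in> vars A" "(MidA, v) \<in> R2" for i v
    using that assms by (cases v) (simp_all add: R2_def glue_def)
  then show "forces R2 (glue U V) MidA A \<longleftrightarrow> forces R2 U MidA A"
    by (rule forces_cong[OF trans_R2 refl _ refl_R2])
  have "v \<in> glue U V i \<longleftrightarrow> v \<in> V i" if "i \<in> vars A" "(MidB, v) \<in> R2" for i v
    using that assms by (cases v) (simp_all add: R2_def glue_def)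
  then show "forces R2 (glue U V) MidB A \<longleftrightarrow> forces R2 V MidB A"
    by (rule forces_cong[OF trans_R2 refl _ refl_R2])
  have "v \<in> glue U V i \<longleftrightarrow> v \<in> U i" if "i \<in> vars A" "(Top, v) \<in> R2" for i v
    using that assms by (cases v) (simp_all add: R2_def glue_def)
  then show "forces R2 (glue U V) Top A \<longleftrightarrow> forces R2 U Top A"
    by (rule forces_cong[OF trans_R2 refl _ refl_R2])
qed

text \<open>\<open>Top\<close> sees only itself, so forcing there is classical evaluation; the
  right-hand valuation is a canonical one with the same truth values of the two variables.\<close>

lemma forces_at_Top:
  assumes "A \<in> Fm 2"
  shows "forces R2 U Top A \<longleftrightarrow>
    forces R2 (\<lambda>i. if (i = 0 \<and> Top \<in> U 0) \<or> (i = 1 \<and> Top \<in> U 1) then {Top} else {}) Top A"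
  using assms
  by (intro forces_cong[OF trans_R2 _ _ refl_R2]) (auto simp: R2_def Fm_def less_2_cases_iff)

theorem theorem5p1:
  fixes L :: "fm set"
  assumes "intermediate_logic L"
    and "L \<subseteq> logic_of_frame UNIV R2"
    and "unitary_unification L"
  shows "\<exists>n. \<exists>A \<in> Fm n. unifiable L n A \<and> \<not> (\<exists>\<epsilon>. mgu L n n A \<epsilon>)"
proof -
  have "\<not> mgu L 2 2 dense_disj \<epsilon>" for \<epsilon>
  proof
    assume mgu: "mgu L 2 2 dense_disj \<epsilon>"
    then have \<epsilon>: "\<epsilon> 0 \<in> Fm 2" "\<epsilon> 1 \<in> Fm 2" "subst \<epsilon> dense_disj \<in> L"
      by (auto simp: mgu_def unifier_def)
    \<comment> \<open>With the variable true at \<open>Top\<close> only, excluded middle for it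
      holds at \<open>Top\<close> and fails at both middle points.\<close>
    let ?V = "\<lambda>_::nat. {Top}"
    have V: "persistent_valuation UNIV R2 ?V"
      by (auto simp: persistent_valuation_def R2_def)
    have inst: "\<exists>U. persistent_valuation UNIV R2 U \<and>
        (\<forall>w. forces R2 U w (\<epsilon> 0) = forces R2 ?V w B) \<and>
        (\<forall>w. forces R2 U w (\<epsilon> 1) = forces R2 ?V w C)"
      if "B \<in> Fm 1" "C \<in> Fm 1" "B = Bot \<or> B = Truth \<or> C = Truth" for B C
    proof -
      have "unifier L 2 1 dense_disj (\<lambda>i. if i = 0 then B else C)"
        using that by (intro unifier_dense_disj assms(1)) auto
      then have "more_general L 2 2 1 \<epsilon> (\<lambda>i. if i = 0 then B else C)"
        using mgu by (simp add: mgu_def)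
      from more_general_valuation[OF assms(2) this V] obtain U
        where "persistent_valuation UNIV R2 U"
          and "\<And>i w. i < 2 \<Longrightarrow> forces R2 U w (\<epsilon> i) \<longleftrightarrow> forces R2 ?V w (if i = 0 then B else C)"
        by blast
      from this(1) this(2)[of 0] this(2)[of 1] show ?thesis by auto
    qed
    define top where "top U = (Top \<in> U 0, Top \<in> U (1::nat))" for U :: "nat \<Rightarrow> rhombus set"
    define val where "val p =
      (let U = \<lambda>i::nat. if (i = 0 \<and> fst p) \<or> (i = 1 \<and> snd p) then {Top} else {}
       in (forces R2 U Top (\<epsilon> 0), forces R2 U Top (\<epsilon> 1)))" for p :: "bool \<times> bool"
    have val_top: "val (top U) = (forces R2 U Top (\<epsilon> 0), forces R2 U Top (\<epsilon> 1))" for U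
      using forces_at_Top[OF \<epsilon>(1), of U] forces_at_Top[OF \<epsilon>(2), of U]
      by (simp add: val_def top_def Let_def)
    let ?D = "Or (Var 0) (Neg (Var 0))"
    obtain U1 where U1: "persistent_valuation UNIV R2 U1"
        "\<And>w. forces R2 U1 w (\<epsilon> 0) = forces R2 ?V w Truth"
        "\<And>w. forces R2 U1 w (\<epsilon> 1) = forces R2 ?V w ?D"
      using inst[of Truth ?D] by (auto simp: Fm_def)
    obtain U2 where U2: "persistent_valuation UNIV R2 U2"
        "\<And>w. forces R2 U2 w (\<epsilon> 0) = forces R2 ?V w ?D"
        "\<And>w. forces R2 U2 w (\<epsilon> 1) = forces R2 ?V w Truth"
      using inst[of ?D Truth] by (auto simp: Fm_def)
    \<comment> \<open>The unifier sending the variables to the constants that code \<open>p\<close>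
      gives a preimage of \<open>p\<close>.\<close>
    have "p \<in> range val" for p
    proof -
      let ?c = "\<lambda>b. if b then Truth else Bot"
      have "?c (fst p) \<in> Fm 1" "?c (snd p) \<in> Fm 1"
          "?c (fst p) = Bot \<or> ?c (fst p) = Truth \<or> ?c (snd p) = Truth"
        by (simp_all add: Fm_def)
      from inst[OF this] obtain U where "\<And>w. forces R2 U w (\<epsilon> 0) = forces R2 ?V w (?c (fst p))"
          "\<And>w. forces R2 U w (\<epsilon> 1) = forces R2 ?V w (?c (snd p))"
        by blast
      then have "val (top U) = p"
        by (cases p) (simp add: val_top)
      then show ?thesis by blast
    qed
    \<comment> \<open>Here it matters that \<epsilon> has only two target variables: domain and
      codomain have the same finite size.\<close>
    then have "inj val"
      by (intro finite_UNIV_surj_inj) auto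
    moreover have "val (top U1) = val (top U2)"
      by (simp add: val_top U1(2,3) U2(2,3) del: One_nat_def)
    ultimately have "top U1 = top U2" by (rule injD)
    then have agree: "\<forall>i\<in>vars A. Top \<in> U1 i \<longleftrightarrow> Top \<in> U2 i" if "A \<in> Fm 2" for A
      using that by (auto simp: top_def Fm_def less_2_cases_iff)
    let ?G = "glue U1 U2"
    note glue = forces_glue[OF agree]
    have top: "forces R2 ?G Top (\<epsilon> 0)" "forces R2 ?G Top (\<epsilon> 1)"
      by (simp_all add: glue(3) \<epsilon>(1,2) U1(2,3) del: One_nat_def)
    have D: "\<not> forces R2 ?V w ?D" if "w = MidA \<or> w = MidB" for w
      using that by (auto simp: R2_def)
    \<comment> \<open>\<open>MidA\<close> inherits \<open>U1\<close>, where
      \<epsilon>\<open>1\<close> acts as \<open>?D\<close>; \<open>MidB\<close> inherits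
      \<open>U2\<close>, where \<epsilon>\<open>0\<close> does.\<close>
    then have mid: "\<not> forces R2 ?G MidA (\<epsilon> 1)" "\<not> forces R2 ?G MidB (\<epsilon> 0)"
      by (simp_all only: glue(1,2) \<epsilon>(1,2) U1(3) U2(2)) simp_all
    have G: "persistent_valuation UNIV R2 ?G"
      using persistent_glue U1(1) U2(1) by blast
    have "(Root, w) \<in> R2" "(w, Top) \<in> R2" for w
      by (simp_all add: R2_def)
    note R2 = this
    have "\<not> forces R2 ?G Root (\<epsilon> 0)" "\<not> forces R2 ?G Root (\<epsilon> 1)"
      using mid forces_mono[OF trans_R2 G _ R2(1)] by blast+
    \<comment> \<open>Every point lies below \<open>Top\<close>, where both formulas hold, so both
      double negations hold at the root while neither disjunct does.\<close>
    then have "\<not> forces R2 ?G Root (subst \<epsilon> dense_disj)"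
      using top R2 by (simp add: dense_disj_def) blast
    moreover have "forces R2 ?G Root (subst \<epsilon> dense_disj)"
      using \<epsilon>(3) assms(2) G by (auto simp: logic_of_frame_def)
    ultimately show False by contradiction
  qed
  moreover have "unifiable L 2 dense_disj"
    using unifier_dense_disj[OF assms(1), of "\<lambda>_. Bot" 0] by (auto simp: unifiable_def Fm_def)
  ultimately show ?thesis
    using dense_disj_Fm by blast
qed

end
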